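(* Let $(G,p)$ be an $r$-dimensional tensegrity framework on $n$ vertices in $\mathbb{R}^r$, for some $r \leq n-2$, with sets of bars, cables and struts $B$, $C$, $S$. Suppose that the following two conditions hold. 1. $(G,p)$ admits a proper positive semidefinite stress matrix $\Omega$ (associated with a proper stress $\omega=(\omega_{ij})$) with rank $n-r-1$. 2. For each vertex $i$, the set $\{p^i\} \cup \{p^j : \{i,j\} \in B \cup C^* \cup S^*\}$ affinely spans $\mathbb{R}^r$, where $C^*=\{\{i,j\}\in C : \omega_{ij}\neq 0\}$ and $S^*=\{\{i,j\}\in S : \omega_{ij}\neq 0\}$. Then $(G,p)$ is universally rigid.
   Context: A tensegrity graph $G=(V,E)$ is a simple connected graph with $V=\{1,\ldots,n\}$ in which each edge is labelled as either a bar, a cable or a strut; $B$, $C$, $S$ denote the sets of bars, cables and struts, so $E=B\cup C\cup S$ (disjoint union). A tensegrity framework $(G,p)$ in $\mathbb{R}^r$ is a tensegrity graph $G$ together with a configuration $p=(p^1,\ldots,p^n)$ of points $p^i\in\mathbb{R}^r$. It is $r$-dimensional if $r$ is the dimension of the affine span of $p^1,\ldots,p^n$. Given $(G,p)$ in $\mathbb{R}^r$ and $(G,q)$ in $\mathbb{R}^s$ (same tensegrity graph $G$): $(G,q)$ is congruent to $(G,p)$ if $\|q^i-q^j\|^2=\|p^i-p^j\|^2$ for all $i,j=1,\ldots,n$. $(G,q)$ is dominated by $(G,p)$ if $\|q^i-q^j\|^2=\|p^i-p^j\|^2$ for each $\{i,j\}\in B$, $\|q^i-q^j\|^2\le\|p^i-p^j\|^2$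 for each $\{i,j\}\in C$, and $\|q^i-q^j\|^2\ge\|p^i-p^j\|^2$ for each $\{i,j\}\in S$. $(G,p)$ is universally rigid if every $s$-dimensional tensegrity framework $(G,q)$ in $\mathbb{R}^s$, for any $s$, that is dominated by $(G,p)$ is congruent to $(G,p)$. A stress of $(G,p)$ is a function $\omega:E\to\mathbb{R}$ such that $\sum_{j:\{i,j\}\in E}\omega_{ij}(p^i-p^j)=0$ for all $i=1,\ldots,n$. It is proper if $\omega_{ij}\ge 0$ for all $\{i,j\}\in C$ and $\omega_{ij}\le 0$ for all $\{i,j\}\in S$. The stress matrix associated with $\omega$ is the $n\times n$ symmetric matrix $\Omega$ with $\Omega_{ij}=-\omega_{ij}$ if $\{i,j\}\in E$, $\Omega_{ij}=0$ if $i\ne j$ and $\{i,j\}\notin E$, and $\Omega_{ii}=\sum_{k:\{i,k\}\in E}\omega_{ik}$. A stress matrix is proper if it is associated with a proper stress. *)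

theory Defs
  imports "Jordan_Normal_Form.DL_Rank"
begin

text \<open>
  Points of \<open>\<real>\<^sup>d\<close> are elements of \<^term>\<open>carrier_vec d :: real vec set\<close>, so that the dimension can be
  quantified over and may be \<open>0\<close>. Vertices are \<open>0, \<dots>, n - 1\<close> instead of \<open>1, \<dots>, n\<close>, matching the
  matrix indices. Edges are two-element vertex sets.
\<close>

record tensegrity =
  num_verts :: nat
  bars :: "nat set set"
  cables :: "nat set set"
  struts :: "nat set set"

definition edges :: "tensegrity \<Rightarrow> nat set set" where
  "edges G = bars G \<union> cables G \<union> struts G"

definition neighbors :: "tensegrity \<Rightarrow> nat \<Rightarrow> nat set" where
  "neighbors G i = {j. {i, j} \<in> edges G}"

definition tensegrity_graph :: "tensegrity \<Rightarrow> bool" where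
  "tensegrity_graph G \<longleftrightarrow>
     (\<forall>e \<in> edges G. \<exists>i j. i < num_verts G \<and> j < num_verts G \<and> i \<noteq> j \<and> e = {i, j}) \<and>
     bars G \<inter> cables G = {} \<and> bars G \<inter> struts G = {} \<and> cables G \<inter> struts G = {} \<and>
     (\<forall>i < num_verts G. \<forall>j < num_verts G. (i, j) \<in> {(u, v). {u, v} \<in> edges G}\<^sup>*)"

definition framework :: "tensegrity \<Rightarrow> nat \<Rightarrow> (nat \<Rightarrow> real vec) \<Rightarrow> bool" where
  "framework G d p \<longleftrightarrow> tensegrity_graph G \<and> (\<forall>i < num_verts G. p i \<in> carrier_vec d)"

definition affine_span :: "nat \<Rightarrow> real vec set \<Rightarrow> real vec set" where
  "affine_span d X =
     {finsum_vec TYPE(real) d (\<lambda>v. c v \<cdot>\<^sub>v v) T | c T. finite T \<and> T \<subseteq> X \<and> sum c T = 1}"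

text \<open>The dimension of an affine subspace is that of its direction space.\<close>

definition affine_dim :: "nat \<Rightarrow> real vec set \<Rightarrow> nat" where
  "affine_dim d A =
     vectorspace.dim class_ring
       ((module_vec TYPE(real) d)\<lparr>carrier := {x - y | x y. x \<in> A \<and> y \<in> A}\<rparr>)"

definition framework_dim :: "tensegrity \<Rightarrow> nat \<Rightarrow> (nat \<Rightarrow> real vec) \<Rightarrow> nat" where
  "framework_dim G d p = affine_dim d (affine_span d (p ` {..<num_verts G}))"

definition sqdist :: "real vec \<Rightarrow> real vec \<Rightarrow> real" where
  "sqdist x y = (x - y) \<bullet> (x - y)"

definition congruent_to :: "tensegrity \<Rightarrow> (nat \<Rightarrow> real vec) \<Rightarrow> (nat \<Rightarrow> real vec) \<Rightarrow> bool" where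
  "congruent_to G q p \<longleftrightarrow>
     (\<forall>i < num_verts G. \<forall>j < num_verts G. sqdist (q i) (q j) = sqdist (p i) (p j))"

text \<open>\<open>dominated_by G q p\<close>: the framework \<open>(G, q)\<close> is dominated by \<open>(G, p)\<close>.\<close>

definition dominated_by :: "tensegrity \<Rightarrow> (nat \<Rightarrow> real vec) \<Rightarrow> (nat \<Rightarrow> real vec) \<Rightarrow> bool" where
  "dominated_by G q p \<longleftrightarrow>
     (\<forall>i j. {i, j} \<in> bars G \<longrightarrow> sqdist (q i) (q j) = sqdist (p i) (p j)) \<and>
     (\<forall>i j. {i, j} \<in> cables G \<longrightarrow> sqdist (q i) (q j) \<le> sqdist (p i) (p j)) \<and>
     (\<forall>i j. {i, j} \<in> struts G \<longrightarrow> sqdist (q i) (q j) \<ge> sqdist (p i) (p j))"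

definition universally_rigid :: "tensegrity \<Rightarrow> (nat \<Rightarrow> real vec) \<Rightarrow> bool" where
  "universally_rigid G p \<longleftrightarrow>
     (\<forall>s q. framework G s q \<and> framework_dim G s q = s \<and> dominated_by G q p
        \<longrightarrow> congruent_to G q p)"

text \<open>Only the values of a stress on the edges are relevant.\<close>

definition stress :: "tensegrity \<Rightarrow> nat \<Rightarrow> (nat \<Rightarrow> real vec) \<Rightarrow> (nat set \<Rightarrow> real) \<Rightarrow> bool" where
  "stress G d p \<omega> \<longleftrightarrow>
     (\<forall>i < num_verts G.
        finsum_vec TYPE(real) d (\<lambda>j. \<omega> {i, j} \<cdot>\<^sub>v (p i - p j)) (neighbors G i) = 0\<^sub>v d)"

definition proper_stress :: "tensegrity \<Rightarrow> nat \<Rightarrow> (nat \<Rightarrow> real vec) \<Rightarrow> (nat set \<Rightarrow> real) \<Rightarrow> bool" where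
  "proper_stress G d p \<omega> \<longleftrightarrow>
     stress G d p \<omega> \<and> (\<forall>e \<in> cables G. \<omega> e \<ge> 0) \<and> (\<forall>e \<in> struts G. \<omega> e \<le> 0)"

definition stress_matrix :: "tensegrity \<Rightarrow> (nat set \<Rightarrow> real) \<Rightarrow> real mat" where
  "stress_matrix G \<omega> = mat (num_verts G) (num_verts G) (\<lambda>(i, j).
     if i = j then \<Sum>k \<in> neighbors G i. \<omega> {i, k}
     else if {i, j} \<in> edges G then - \<omega> {i, j}
     else 0)"

definition pos_semidef :: "nat \<Rightarrow> real mat \<Rightarrow> bool" where
  "pos_semidef n A \<longleftrightarrow>
     A \<in> carrier_mat n n \<and> transpose_mat A = A \<and> (\<forall>x \<in> carrier_vec n. x \<bullet> (A *\<^sub>v x) \<ge> 0)"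

end

theory Submission
  imports Defs "Jordan_Normal_Form.Matrix_Kernel"
begin

text \<open>
  By the rank condition the kernel of \<open>\<Omega>\<close> consists exactly of the vectors \<open>(f (p i))\<^sub>i\<close> with \<open>f\<close>
  affine. If \<open>q\<close> is dominated by \<open>p\<close>, properness bounds the stress energy of \<open>q\<close> by that of \<open>p\<close>,
  which is \<open>0\<close>. Since \<open>\<Omega>\<close> is positive semidefinite, the coordinates of \<open>q\<close> therefore lie in the kernel
  too, and every edge with nonzero stress keeps its length.

  The difference of the Gram matrices, \<open>h i j = q i \<bullet> q j - p i \<bullet> p j\<close>, then has all its rows in the
  kernel. So does its diagonal, because
  \<open>2 * h i j - h i i - h j j = sqdist (p i) (p j) - sqdist (q i) (q j)\<close> vanishes wherever
  \<open>\<Omega>\<close> has a nonzero off-diagonal entry. For fixed \<open>i\<close> this expression in \<open>j\<close> is thus an affine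
  function of \<open>p j\<close>. It vanishes at \<open>i\<close> and at its neighbours along \<open>B \<union> C\<^sup>* \<union> S\<^sup>*\<close>, whose
  points affinely span the space, so it vanishes identically.
\<close>

section \<open>Kernels of matrices and of positive semidefinite forms\<close>

lemma mult_mat_vec_module_hom:
  fixes A :: "'a :: field mat"
  assumes A: "A \<in> carrier_mat nr nc"
  shows "(*\<^sub>v) A \<in> LinearCombinations.module_hom class_ring (module_vec TYPE('a) nc) (module_vec TYPE('a) nr)"
  using mult_mat_vec_carrier[OF A] mult_add_distrib_mat_vec[OF A] mult_mat_vec[OF A]
  by (simp add: LinearCombinations.module_hom_def module_vec_simps)

lemma rank_plus_kernel_dim:
  fixes A :: "'a :: field mat"
  assumes A: "A \<in> carrier_mat nr nc"
  shows "vec_space.rank nr A + kernel.dim nc A = nc"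
proof -
  interpret k: kernel nr nc A by unfold_locales (rule A)
  interpret R: vec_space "TYPE('a)" nr .
  interpret lm: linear_map class_ring "module_vec TYPE('a) nc" "module_vec TYPE('a) nr" "(*\<^sub>v) A"
    by unfold_locales (rule mult_mat_vec_module_hom[OF A])
  have ker: "lm.kerT = mat_kernel A"
    unfolding lm.mod_hom.ker_def mat_kernel[OF A] module_vec_simps ..
  have im: "lm.imT = R.span (set (cols A))"
    using R.col_space_eq[OF A] A
    unfolding lm.mod_hom.im_def R.col_space_def[symmetric] module_vec_simps by auto
  from lm.rank_nullity[OF k.NC.fin_dim] show ?thesis
    unfolding ker im R.rank_def k.NC.dim_is_n .
qed

text \<open>The columns of \<open>B\<close> lie in the kernel of \<open>A\<close>, are independent
  by injectivity, and match its dimension in number by rank-nullity; hence they form a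
  basis.\<close>

lemma mat_kernel_eq_range:
  fixes A B :: "'a :: field mat"
  assumes A: "A \<in> carrier_mat nr n" and B: "B \<in> carrier_mat n m"
    and rank: "vec_space.rank nr A + m = n"
    and AB: "A * B = 0\<^sub>m nr m"
    and inj: "\<And>v. v \<in> carrier_vec m \<Longrightarrow> B *\<^sub>v v = 0\<^sub>v n \<Longrightarrow> v = 0\<^sub>v m"
  shows "mat_kernel A = {B *\<^sub>v v | v. v \<in> carrier_vec m}"
proof -
  interpret k: kernel nr n A by unfold_locales (rule A)
  have unit: "col B j = B *\<^sub>v unit_vec m j" if "j < m" for j
    using that B by auto
  \<comment> \<open>Independence is stated for the set of columns, so equal columns must be ruled
    out: they would put a difference of unit vectors into the kernel of \<open>B\<close>.\<close>
  have dist: "distinct (cols B)"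
    unfolding distinct_conv_nth
  proof (intro allI impI notI)
    fix i j assume i: "i < length (cols B)" and j: "j < length (cols B)" and ij: "i \<noteq> j"
      and eq: "cols B ! i = cols B ! j"
    have im: "i < m" "j < m" using i j B by auto
    have "B *\<^sub>v (unit_vec m i - unit_vec m j) = 0\<^sub>v n"
      using eq im B by (simp add: mult_minus_distrib_mat_vec unit[symmetric])
    from inj[OF _ this] have "(unit_vec m i - unit_vec m j) $ i = (0\<^sub>v m :: 'a vec) $ i" by auto
    with im ij show False by auto
  qed
  have sub: "set (cols B) \<subseteq> mat_kernel A"
  proof
    fix x assume "x \<in> set (cols B)"
    then obtain j where j: "j < m" "x = col B j"
      using B by (metis carrier_matD(2) cols_length cols_nth in_set_conv_nth)
    have "A *\<^sub>v x = col (A * B) j" unfolding j(2) by (rule col_mult2[OF A B j(1), symmetric])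
    then show "x \<in> mat_kernel A" using AB j A B by (auto simp: mat_kernel)
  qed
  have card: "card (set (cols B)) = m" using distinct_card[OF dist] B by simp
  have "k.NC.lin_indpt (set (cols B))"
    using k.NC.lin_depE[OF B _ dist] inj by blast
  then have li: "k.lin_indpt (set (cols B))" using k.lindep_same[OF sub] by simp
  have dim: "k.dim = m" using rank_plus_kernel_dim[OF A] rank by simp
  obtain S where "finite S" "k.basis S"
    using kernel_basis_exists[OF A] by auto
  then have fd: "k.Ker.fin_dim" unfolding k.Ker.fin_dim_def k.Ker.basis_def by auto
  have "k.basis (set (cols B))"
    by (rule k.Ker.dim_li_is_basis[OF fd _ _ li]) (use sub card dim in auto)
  then have "mat_kernel A = k.NC.span (set (cols B))"
    using k.span_same[OF sub] by (simp add: k.Ker.basis_def)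
  also have "\<dots> = {B *\<^sub>v v | v. v \<in> carrier_vec m}"
    using k.NC.col_space_eq[OF B] B by (auto simp: k.NC.col_space_def)
  finally show ?thesis .
qed

text \<open>With \<open>y = A *\<^sub>v x\<close>, the form at \<open>x + t y\<close> is
  \<open>2 t (y \<bullet> y) + t\<^sup>2 c\<close>. Nonnegativity for all \<open>t\<close> forbids a
  nonzero slope at \<open>t = 0\<close>, so \<open>y = 0\<close>.\<close>

lemma pos_semidef_quadratic_zero:
  assumes psd: "pos_semidef n A" and x: "x \<in> carrier_vec n" and zero: "x \<bullet> (A *\<^sub>v x) = 0"
  shows "A *\<^sub>v x = 0\<^sub>v n"
proof -
  have A: "A \<in> carrier_mat n n" and sym: "transpose_mat A = A"
    and nonneg: "\<And>v. v \<in> carrier_vec n \<Longrightarrow> v \<bullet> (A *\<^sub>v v) \<ge> 0"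
    using psd by (auto simp: pos_semidef_def)
  define y where "y = A *\<^sub>v x"
  have y: "y \<in> carrier_vec n" using A x by (auto simp: y_def)
  have Ay: "A *\<^sub>v y \<in> carrier_vec n" using A y by auto
  have xAy: "x \<bullet> (A *\<^sub>v y) = y \<bullet> y"
    using transpose_vec_mult_scalar[OF A y x] sym comm_scalar_prod[OF y Ay]
    by (metis y_def Ay comm_scalar_prod x y)
  define c where "c = y \<bullet> (A *\<^sub>v y)"
  define s where "s = y \<bullet> y"
  \<comment> \<open>the minimiser \<open>- s / c\<close> of \<open>2 * t * s + t\<^sup>2 * c\<close>, with the denominator kept positive\<close>
  define t where "t = - s / (c + 1)"
  have c: "c \<ge> 0" using nonneg[OF y] by (simp add: c_def)
  have "(x + t \<cdot>\<^sub>v y) \<bullet> (A *\<^sub>v (x + t \<cdot>\<^sub>v y)) = (x + t \<cdot>\<^sub>v y) \<bullet> (y + t \<cdot>\<^sub>v (A *\<^sub>v y))"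
    using A x y by (simp add: mult_add_distrib_mat_vec mult_mat_vec y_def)
  also have "\<dots> = x \<bullet> y + t * s + (t * s + t * t * c)"
    using A x y Ay xAy
    by (simp add: add_scalar_prod_distrib[of _ n] scalar_prod_add_distrib[of _ n] s_def c_def algebra_simps)
  finally have "0 \<le> 2 * t * s + t * t * c"
    using nonneg[of "x + t \<cdot>\<^sub>v y"] x y zero by (simp add: y_def algebra_simps)
  \<comment> \<open>Eliminating \<open>s\<close> turns the bound into
    \<open>0 \<le> - t\<^sup>2 * (c + 2)\<close>, which forces \<open>t = 0\<close> and hence
    \<open>s = 0\<close>.\<close>
  also have "s = - t * (c + 1)" using c by (simp add: t_def)
  finally have "t\<^sup>2 * (c + 2) \<le> 0" by (simp add: power2_eq_square algebra_simps)
  then have "t = 0" using c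
    by (smt (verit) mult_pos_pos zero_less_power2)
  then have "s = 0" using c by (simp add: t_def)
  then have "(\<Sum>i<n. y $ i * y $ i) = 0"
    using y by (simp add: s_def scalar_prod_def lessThan_atLeast0)
  then have "\<forall>i<n. y $ i * y $ i = 0"
    by (subst (asm) sum_nonneg_eq_0_iff) auto
  then show ?thesis using y by (auto simp: y_def[symmetric] intro!: eq_vecI)
qed

section \<open>Affine functions on affine spans\<close>

text \<open>The coefficients of an affine combination sum to 1, so the constant \<open>b\<close>
  passes through it unchanged.\<close>

lemma affine_span_vanish:
  assumes X: "X \<subseteq> carrier_vec d" and u: "u \<in> carrier_vec d"
    and zero: "\<And>x. x \<in> X \<Longrightarrow> u \<bullet> x + b = 0"
    and y: "y \<in> affine_span d X"
  shows "u \<bullet> y + b = (0::real)"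
proof -
  interpret V: vec_space "TYPE(real)" d .
  from y obtain c T where yc: "y = finsum_vec TYPE(real) d (\<lambda>v. c v \<cdot>\<^sub>v v) T"
    and T: "finite T" "T \<subseteq> X" and c: "sum c T = 1"
    by (auto simp: affine_span_def)
  have f: "(\<lambda>v. c v \<cdot>\<^sub>v v) \<in> T \<rightarrow> carrier_vec d" using T X by auto
  have yd: "y \<in> carrier_vec d" unfolding yc by (rule finsum_vec_closed[OF f])
  have "u \<bullet> y = y \<bullet> u" by (rule comm_scalar_prod[OF u yd])
  also have "\<dots> = (\<Sum>v\<in>T. (c v \<cdot>\<^sub>v v) \<bullet> u)"
    unfolding yc V.finsum_vec by (rule V.finsum_scalar_prod_sum[OF f u])
  also have "\<dots> = (\<Sum>v\<in>T. c v * (- b))"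
  proof (rule sum.cong[OF refl])
    fix v assume "v \<in> T"
    then have v: "v \<in> carrier_vec d" "v \<in> X" using T X by auto
    show "(c v \<cdot>\<^sub>v v) \<bullet> u = c v * (- b)"
      using v u zero[OF v(2)] comm_scalar_prod[OF u v(1)] by (simp flip: distrib_left add: eq_neg_iff_add_eq_0)
  qed
  also have "\<dots> = - b" by (simp only: sum_distrib_right[symmetric] c mult_1_left)
  finally show ?thesis by simp
qed

text \<open>Evaluation at the origin gives \<open>b\<close>, and then evaluation at the unit vectors
  gives the entries of \<open>u\<close>.\<close>

lemma affine_spanning_vanish:
  assumes X: "X \<subseteq> carrier_vec d" and u: "u \<in> carrier_vec d"
    and zero: "\<And>x. x \<in> X \<Longrightarrow> u \<bullet> x + b = 0"
    and span: "affine_span d X = carrier_vec d"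
  shows "u = 0\<^sub>v d" "b = (0::real)"
proof -
  have *: "u \<bullet> y + b = 0" if "y \<in> carrier_vec d" for y
    using affine_span_vanish[OF X u zero] that span by auto
  from *[of "0\<^sub>v d"] u show b: "b = 0" by simp
  show "u = 0\<^sub>v d"
  proof (rule eq_vecI)
    fix i assume "i < dim_vec (0\<^sub>v d :: real vec)"
    then show "u $ i = 0\<^sub>v d $ i" using *[of "unit_vec d i"] u b by simp
  qed (use u in simp)
qed

section \<open>The stress matrix as a weighted Laplacian\<close>

text \<open>Extending the stress by 0 to all pairs turns sums over neighbours into sums over all
  vertices, so that double sums can be swapped.\<close>

definition edge_weight :: "tensegrity \<Rightarrow> (nat set \<Rightarrow> real) \<Rightarrow> nat \<Rightarrow> nat \<Rightarrow> real" where
  "edge_weight G \<omega> i j = (if {i, j} \<in> edges G then \<omega> {i, j} else 0)"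

lemma edge_weight_sym: "edge_weight G \<omega> i j = edge_weight G \<omega> j i"
  by (simp add: edge_weight_def insert_commute)

lemma neighbors_subset:
  assumes "tensegrity_graph G" shows "neighbors G i \<subseteq> {..<num_verts G} - {i}"
proof
  fix j assume "j \<in> neighbors G i"
  then obtain a b where "a < num_verts G" "b < num_verts G" "a \<noteq> b" "{i, j} = {a, b}"
    using assms unfolding tensegrity_graph_def neighbors_def by blast
  then show "j \<in> {..<num_verts G} - {i}" by (auto simp: doubleton_eq_iff)
qed

lemma sum_neighbors:
  assumes "tensegrity_graph G"
  shows "(\<Sum>j\<in>neighbors G i. \<omega> {i, j} * f j) = (\<Sum>j<num_verts G. edge_weight G \<omega> i j * f j)"
proof -
  have "(\<Sum>j\<in>neighbors G i. \<omega> {i, j} * f j) = (\<Sum>j\<in>neighbors G i. edge_weight G \<omega> i j * f j)"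
    by (rule sum.cong) (auto simp: edge_weight_def neighbors_def)
  also have "\<dots> = (\<Sum>j<num_verts G. edge_weight G \<omega> i j * f j)"
    using neighbors_subset[OF assms, of i]
    by (intro sum.mono_neutral_left) (auto simp: edge_weight_def neighbors_def)
  finally show ?thesis .
qed

text \<open>Every row of the stress matrix sums to zero, so only differences enter. Kernel vectors
  are thus the functions in equilibrium at every vertex.\<close>

lemma stress_matrix_mult_vec:
  assumes "tensegrity_graph G" and i: "i < num_verts G"
  shows "(stress_matrix G \<omega> *\<^sub>v vec (num_verts G) x) $ i =
    (\<Sum>j<num_verts G. edge_weight G \<omega> i j * (x i - x j))"
proof -
  have loop: "{i} \<notin> edges G"
    using neighbors_subset[OF assms(1), of i] by (force simp: neighbors_def)
  have d: "(\<Sum>k\<in>neighbors G i. \<omega> {i, k}) = (\<Sum>j<num_verts G. edge_weight G \<omega> i j)"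
    using sum_neighbors[OF assms(1), where f = "\<lambda>_. 1"] by simp
  have "(stress_matrix G \<omega> *\<^sub>v vec (num_verts G) x) $ i =
     (\<Sum>j<num_verts G. stress_matrix G \<omega> $$ (i, j) * x j)"
    using i by (simp add: stress_matrix_def scalar_prod_def lessThan_atLeast0)
  also have "\<dots> = (\<Sum>j<num_verts G. (if j = i then (\<Sum>k\<in>neighbors G i. \<omega> {i, k}) * x i else 0)
       - edge_weight G \<omega> i j * x j)"
    using i loop by (intro sum.cong) (auto simp: stress_matrix_def edge_weight_def)
  also have "\<dots> = (\<Sum>j<num_verts G. edge_weight G \<omega> i j * (x i - x j))"
    using i by (simp add: sum_subtractf d algebra_simps sum_distrib_left)
  finally show ?thesis .
qed

text \<open>Exchanging \<open>i\<close> and \<open>j\<close> gives a second form of the sum; adding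
  the two pairs \<open>x i * (x i - x j)\<close> with \<open>x j * (x j - x i)\<close>, which
  together make the square.\<close>

lemma symmetric_energy:
  fixes W :: "'a \<Rightarrow> 'a \<Rightarrow> real"
  assumes "\<And>i j. W i j = W j i"
  shows "2 * (\<Sum>i\<in>I. x i * (\<Sum>j\<in>I. W i j * (x i - x j))) = (\<Sum>i\<in>I. \<Sum>j\<in>I. W i j * (x i - x j)\<^sup>2)"
proof -
  have "(\<Sum>i\<in>I. x i * (\<Sum>j\<in>I. W i j * (x i - x j))) = (\<Sum>i\<in>I. \<Sum>j\<in>I. x i * (W i j * (x i - x j)))" (is "?S = _")
    by (simp add: sum_distrib_left)
  moreover have "\<dots> = (\<Sum>i\<in>I. \<Sum>j\<in>I. x j * (W i j * (x j - x i)))"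
    by (subst sum.swap) (simp add: assms)
  ultimately have "2 * ?S = (\<Sum>i\<in>I. \<Sum>j\<in>I. x i * (W i j * (x i - x j)) + x j * (W i j * (x j - x i)))"
    by (simp add: sum.distrib)
  also have "\<dots> = (\<Sum>i\<in>I. \<Sum>j\<in>I. W i j * (x i - x j)\<^sup>2)"
    by (intro sum.cong refl) (simp add: algebra_simps power2_eq_square)
  finally show ?thesis .
qed

lemma sqdist_coords:
  assumes "x \<in> carrier_vec d" "y \<in> carrier_vec d"
  shows "sqdist x y = (\<Sum>k<d. (x $ k - y $ k)\<^sup>2)"
  using assms by (simp add: sqdist_def scalar_prod_def lessThan_atLeast0 power2_eq_square)

lemma sqdist_scalar_prod:
  assumes "x \<in> carrier_vec d" "y \<in> carrier_vec d"
  shows "sqdist x y = x \<bullet> x + y \<bullet> y - 2 * (x \<bullet> y)"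
proof -
  have "sqdist x y = (\<Sum>k<d. x $ k * x $ k + y $ k * y $ k - 2 * (x $ k * y $ k))"
    unfolding sqdist_coords[OF assms] by (simp add: power2_eq_square algebra_simps)
  also have "\<dots> = x \<bullet> x + y \<bullet> y - 2 * (x \<bullet> y)"
    unfolding sum_subtractf sum.distrib sum_distrib_left[symmetric]
    using assms by (simp add: scalar_prod_def lessThan_atLeast0)
  finally show ?thesis .
qed

section \<open>Equilibrium and stress energy\<close>

lemma stress_coords:
  assumes "framework G d p" and "stress G d p \<omega>" and i: "i < num_verts G" and k: "k < d"
  shows "(\<Sum>j<num_verts G. edge_weight G \<omega> i j * (p i $ k - p j $ k)) = 0"
proof -
  have G: "tensegrity_graph G" and p: "\<And>i. i < num_verts G \<Longrightarrow> p i \<in> carrier_vec d"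
    using assms by (auto simp: framework_def)
  have N: "neighbors G i \<subseteq> {..<num_verts G}" using neighbors_subset[OF G, of i] by auto
  then have fin: "finite (neighbors G i)" using finite_subset by blast
  have c: "(\<lambda>j. \<omega> {i, j} \<cdot>\<^sub>v (p i - p j)) \<in> neighbors G i \<rightarrow> carrier_vec d"
    using N p i by auto
  have "0 = finsum_vec TYPE(real) d (\<lambda>j. \<omega> {i, j} \<cdot>\<^sub>v (p i - p j)) (neighbors G i) $ k"
    using assms by (simp add: stress_def)
  also have "\<dots> = (\<Sum>j\<in>neighbors G i. (\<omega> {i, j} \<cdot>\<^sub>v (p i - p j)) $ k)"
    by (rule index_finsum_vec[OF fin k c])
  also have "\<dots> = (\<Sum>j\<in>neighbors G i. \<omega> {i, j} * (p i $ k - p j $ k))"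
  proof (rule sum.cong[OF refl])
    fix j assume "j \<in> neighbors G i"
    then have "p j \<in> carrier_vec d" using N p by auto
    then show "(\<omega> {i, j} \<cdot>\<^sub>v (p i - p j)) $ k = \<omega> {i, j} * (p i $ k - p j $ k)"
      using p[OF i] k by simp
  qed
  also have "\<dots> = (\<Sum>j<num_verts G. edge_weight G \<omega> i j * (p i $ k - p j $ k))"
    by (rule sum_neighbors[OF G])
  finally show ?thesis by simp
qed

text \<open>The \<open>r\<close> coordinate functions of \<open>p\<close> and the constant 1 lie in
  the kernel, which has dimension \<open>r + 1\<close> by the rank condition. They are independent
  because \<open>X\<close> affinely spans the space, so they form a basis.\<close>

lemma equilibrium_affine:
  assumes fw: "framework G r p" and st: "stress G r p \<omega>"
    and rank: "vec_space.rank (num_verts G) (stress_matrix G \<omega>) + (r + 1) = num_verts G"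
    and span: "X \<subseteq> p ` {..<num_verts G}" "affine_span r X = carrier_vec r"
    and x: "\<And>i. i < num_verts G \<Longrightarrow> (\<Sum>j<num_verts G. edge_weight G \<omega> i j * (x i - x j)) = 0"
  obtains u b where "u \<in> carrier_vec r" "\<And>i. i < num_verts G \<Longrightarrow> x i = u \<bullet> p i + b"
proof -
  let ?n = "num_verts G" and ?A = "stress_matrix G \<omega>"
  have G: "tensegrity_graph G" and p: "\<And>i. i < ?n \<Longrightarrow> p i \<in> carrier_vec r"
    using fw by (auto simp: framework_def)
  have A: "?A \<in> carrier_mat ?n ?n" by (simp add: stress_matrix_def)
  have ker: "?A *\<^sub>v vec ?n y = 0\<^sub>v ?n"
    if "\<And>i. i < ?n \<Longrightarrow> (\<Sum>j<?n. edge_weight G \<omega> i j * (y i - y j)) = 0" for y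
    using A that by (intro eq_vecI) (simp_all add: stress_matrix_mult_vec[OF G] del: index_mult_mat_vec)
  \<comment> \<open>Columns below \<open>r\<close> hold the coordinates and column \<open>r\<close>
    the constant 1, so \<open>B *\<^sub>v v\<close> lists the values at the points
    \<open>p i\<close> of an affine function with constant term \<open>v $ r\<close>.\<close>
  define c where "c k i = (if k < r then p i $ k else 1)" for k i
  define B where "B = mat ?n (r + 1) (\<lambda>(i, k). c k i)"
  have B: "B \<in> carrier_mat ?n (r + 1)" by (simp add: B_def)
  have B_mult: "(B *\<^sub>v v) $ i = vec r (($) v) \<bullet> p i + v $ r"
    if "v \<in> carrier_vec (r + 1)" "i < ?n" for v i
    using that p[OF that(2)]
    by (simp add: B_def scalar_prod_def c_def mult.commute)
  have AB: "?A * B = 0\<^sub>m ?n (r + 1)"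
  proof (rule mat_col_eqI)
    fix k assume "k < dim_col (0\<^sub>m ?n (r + 1) :: real mat)"
    then have k: "k < r + 1" by simp
    have "col (?A * B) k = ?A *\<^sub>v col B k" by (rule col_mult2[OF A B k])
    also have "col B k = vec ?n (c k)" using k by (auto simp: B_def)
    also have "?A *\<^sub>v \<dots> = 0\<^sub>v ?n"
      by (rule ker) (simp add: c_def stress_coords[OF fw st])
    finally show "col (?A * B) k = col (0\<^sub>m ?n (r + 1)) k" using k by simp
  qed (use A B in auto)
  have X: "X \<subseteq> carrier_vec r" using span(1) p by auto
  have inj: "v = 0\<^sub>v (r + 1)" if v: "v \<in> carrier_vec (r + 1)" and 0: "B *\<^sub>v v = 0\<^sub>v ?n" for v
  proof -
    have "vec r (($) v) \<bullet> y + v $ r = 0" if "y \<in> X" for y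
      using span(1) that B_mult[OF v] 0 by auto
    from affine_spanning_vanish[OF X _ this span(2)]
    have *: "vec r (($) v) = 0\<^sub>v r" "v $ r = 0" by auto
    show ?thesis
    proof (rule eq_vecI)
      fix k assume "k < dim_vec (0\<^sub>v (r + 1) :: real vec)"
      then show "v $ k = 0\<^sub>v (r + 1) $ k"
        using *(2) arg_cong[OF *(1), of "\<lambda>w. w $ k"] by (cases "k = r") auto
    qed (use v in simp)
  qed
  have "vec ?n x \<in> mat_kernel ?A" using ker[OF x] A by (auto simp: mat_kernel)
  then obtain v where v: "v \<in> carrier_vec (r + 1)" "vec ?n x = B *\<^sub>v v"
    using mat_kernel_eq_range[OF A B rank AB inj] by auto
  have "x i = vec r (($) v) \<bullet> p i + v $ r" if "i < ?n" for i
    using arg_cong[OF v(2), of "\<lambda>w. w $ i"] B_mult[OF v(1) that] that by simp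
  then show thesis by (rule that[OF vec_carrier])
qed

text \<open>Links the quadratic form, which semidefiniteness controls, with squared lengths, which
  domination controls. The factor 2 arises because the double sum counts each edge in both
  orders.\<close>

lemma stress_energy_identity:
  assumes "tensegrity_graph G" and q: "\<And>i. i < num_verts G \<Longrightarrow> q i \<in> carrier_vec s"
  shows "2 * (\<Sum>k<s. vec (num_verts G) (\<lambda>i. q i $ k) \<bullet> (stress_matrix G \<omega> *\<^sub>v vec (num_verts G) (\<lambda>i. q i $ k))) =
    (\<Sum>i<num_verts G. \<Sum>j<num_verts G. edge_weight G \<omega> i j * sqdist (q i) (q j))"
proof -
  let ?n = "num_verts G" and ?W = "edge_weight G \<omega>"
  let ?x = "\<lambda>k. vec ?n (\<lambda>i. q i $ k)"
  have "2 * (?x k \<bullet> (stress_matrix G \<omega> *\<^sub>v ?x k)) = (\<Sum>i<?n. \<Sum>j<?n. ?W i j * (q i $ k - q j $ k)\<^sup>2)" for k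
  proof -
    have "?x k \<bullet> (stress_matrix G \<omega> *\<^sub>v ?x k) = (\<Sum>i<?n. ?x k $ i * (stress_matrix G \<omega> *\<^sub>v ?x k) $ i)"
      by (simp add: scalar_prod_def lessThan_atLeast0 stress_matrix_def)
    also have "\<dots> = (\<Sum>i<?n. q i $ k * (\<Sum>j<?n. ?W i j * (q i $ k - q j $ k)))"
      by (intro sum.cong refl)
        (simp add: stress_matrix_mult_vec[OF assms(1)] del: index_mult_mat_vec)
    finally show ?thesis
      using symmetric_energy[where W = ?W and I = "{..<?n}" and x = "\<lambda>i. q i $ k", OF edge_weight_sym]
      by simp
  qed
  then have "2 * (\<Sum>k<s. ?x k \<bullet> (stress_matrix G \<omega> *\<^sub>v ?x k)) =
      (\<Sum>k<s. \<Sum>i<?n. \<Sum>j<?n. ?W i j * (q i $ k - q j $ k)\<^sup>2)"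
    by (simp add: sum_distrib_left)
  also have "\<dots> = (\<Sum>i<?n. \<Sum>j<?n. \<Sum>k<s. ?W i j * (q i $ k - q j $ k)\<^sup>2)"
    by (subst sum.swap, rule sum.cong[OF refl], subst sum.swap) simp
  also have "\<dots> = (\<Sum>i<?n. \<Sum>j<?n. ?W i j * sqdist (q i) (q j))"
    by (intro sum.cong refl) (simp add: sqdist_coords[OF q q] sum_distrib_left)
  finally show ?thesis .
qed

text \<open>The energy of \<open>q\<close> is at least 0 by semidefiniteness and, term by term, at
  most that of \<open>p\<close>, which is 0. Equality of the totals forces equality
  everywhere.\<close>

lemma dominated_equilibrium:
  assumes fp: "framework G r p" and fq: "framework G s q" and dom: "dominated_by G q p"
    and ps: "proper_stress G r p \<omega>" and psd: "pos_semidef (num_verts G) (stress_matrix G \<omega>)"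
  shows "i < num_verts G \<Longrightarrow> k < s \<Longrightarrow>
      (\<Sum>j<num_verts G. edge_weight G \<omega> i j * (q i $ k - q j $ k)) = 0"
    and "i < num_verts G \<Longrightarrow> j < num_verts G \<Longrightarrow>
      edge_weight G \<omega> i j * sqdist (q i) (q j) = edge_weight G \<omega> i j * sqdist (p i) (p j)"
proof -
  let ?n = "num_verts G" and ?A = "stress_matrix G \<omega>" and ?W = "edge_weight G \<omega>"
  let ?x = "\<lambda>q k. vec ?n (\<lambda>i. q i $ k)"
  let ?e = "\<lambda>q k. ?x q k \<bullet> (?A *\<^sub>v ?x q k)"
  have G: "tensegrity_graph G" and p: "\<And>i. i < ?n \<Longrightarrow> p i \<in> carrier_vec r"
    and q: "\<And>i. i < ?n \<Longrightarrow> q i \<in> carrier_vec s"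
    using fp fq by (auto simp: framework_def)
  have A: "?A \<in> carrier_mat ?n ?n" by (simp add: stress_matrix_def)
  have st: "stress G r p \<omega>" using ps by (simp add: proper_stress_def)
  have "?A *\<^sub>v ?x p k = 0\<^sub>v ?n" if "k < r" for k
    using A stress_coords[OF fp st _ that]
    by (intro eq_vecI) (simp_all add: stress_matrix_mult_vec[OF G] del: index_mult_mat_vec)
  then have "(\<Sum>k<r. ?e p k) = 0" by simp
  then have Ep: "(\<Sum>i<?n. \<Sum>j<?n. ?W i j * sqdist (p i) (p j)) = 0"
    using stress_energy_identity[where q = p and \<omega> = \<omega>, OF G p] by simp
  \<comment> \<open>Bars give equality for either sign of the stress; on cables and struts the sign
    of a proper stress matches the direction of the length inequality.\<close>
  have le: "?W i j * sqdist (q i) (q j) \<le> ?W i j * sqdist (p i) (p j)" for i j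
    using dom ps unfolding dominated_by_def proper_stress_def edge_weight_def edges_def
    by (auto intro: mult_left_mono mult_left_mono_neg)
  have nonneg: "?e q k \<ge> 0" for k using psd by (auto simp: pos_semidef_def)
  have Eq: "2 * (\<Sum>k<s. ?e q k) = (\<Sum>i<?n. \<Sum>j<?n. ?W i j * sqdist (q i) (q j))"
    by (rule stress_energy_identity[OF G q])
  also have "\<dots> \<le> (\<Sum>i<?n. \<Sum>j<?n. ?W i j * sqdist (p i) (p j))"
    by (intro sum_mono le)
  finally have "(\<Sum>k<s. ?e q k) \<le> 0" using Ep by simp
  moreover have "(\<Sum>k<s. ?e q k) \<ge> 0" by (intro sum_nonneg nonneg)
  ultimately have zero: "(\<Sum>k<s. ?e q k) = 0" by simp
  then have "?e q k = 0" if "k < s" for k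
    using that nonneg by (subst (asm) sum_nonneg_eq_0_iff) auto
  then have ker: "?A *\<^sub>v ?x q k = 0\<^sub>v ?n" if "k < s" for k
    using pos_semidef_quadratic_zero[OF psd] that by simp
  show "(\<Sum>j<?n. ?W i j * (q i $ k - q j $ k)) = 0" if "i < ?n" "k < s" for i k
    using arg_cong[OF ker[OF that(2)], of "\<lambda>v. v $ i"] that(1)
    by (simp add: stress_matrix_mult_vec[OF G] del: index_mult_mat_vec)
  have "(\<Sum>i<?n. \<Sum>j<?n. ?W i j * sqdist (p i) (p j) - ?W i j * sqdist (q i) (q j)) = 0"
    using Eq Ep zero by (simp add: sum_subtractf)
  then have "\<forall>i<?n. (\<Sum>j<?n. ?W i j * sqdist (p i) (p j) - ?W i j * sqdist (q i) (q j)) = 0"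
    using le by (subst (asm) sum_nonneg_eq_0_iff) (auto intro: sum_nonneg)
  then have "\<forall>i<?n. \<forall>j<?n. ?W i j * sqdist (p i) (p j) - ?W i j * sqdist (q i) (q j) = 0"
    using le by (simp add: sum_nonneg_eq_0_iff)
  then show "?W i j * sqdist (q i) (q j) = ?W i j * sqdist (p i) (p j)" if "i < ?n" "j < ?n" for i j
    using that by fastforce
qed

section \<open>Universal rigidity from the difference of Gram matrices\<close>

theorem theorem2p1:
  fixes G :: tensegrity and n r :: nat and p :: "nat \<Rightarrow> real vec"
    and \<omega> :: "nat set \<Rightarrow> real" and \<Omega> :: "real mat"
  assumes "num_verts G = n"
    and "framework G r p"
    and "framework_dim G r p = r"
    and "r + 2 \<le> n"
    and "proper_stress G r p \<omega>"
    and "\<Omega> = stress_matrix G \<omega>"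
    and "pos_semidef n \<Omega>"
    and "vec_space.rank n \<Omega> = n - r - 1"
    and "\<forall>i < n.
      affine_span r ({p i} \<union> {p j | j. {i, j} \<in>
        bars G \<union> {e \<in> cables G. \<omega> e \<noteq> 0} \<union> {e \<in> struts G. \<omega> e \<noteq> 0}}) = carrier_vec r"
  shows "universally_rigid G p"
  unfolding universally_rigid_def congruent_to_def
proof (intro allI impI, elim conjE)
  fix s q i l
  assume fq: "framework G s q" and dom: "dominated_by G q p"
    and i: "i < num_verts G" and l: "l < num_verts G"
  let ?n = "num_verts G" and ?W = "edge_weight G \<omega>"
  let ?N = "{j. {i, j} \<in> bars G \<union> {e \<in> cables G. \<omega> e \<noteq> 0} \<union> {e \<in> struts G. \<omega> e \<noteq> 0}}"
  let ?X = "p ` insert i ?N"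
  note fp = assms(2)
  have G: "tensegrity_graph G" and p: "\<And>i. i < ?n \<Longrightarrow> p i \<in> carrier_vec r"
    and q: "\<And>i. i < ?n \<Longrightarrow> q i \<in> carrier_vec s"
    using fp fq by (auto simp: framework_def)
  have st: "stress G r p \<omega>" using assms(5) by (simp add: proper_stress_def)
  have psd: "pos_semidef ?n (stress_matrix G \<omega>)" using assms by simp
  note eq_p = stress_coords[OF fp st] and eq_q = dominated_equilibrium(1)[OF fp fq dom assms(5) psd]
    and length_eq = dominated_equilibrium(2)[OF fp fq dom assms(5) psd]
  have N: "?N \<subseteq> neighbors G i" by (auto simp: neighbors_def edges_def)
  then have Nn: "j < ?n" if "j \<in> insert i ?N" for j
    using neighbors_subset[OF G, of i] i that by auto
  have N_length: "sqdist (q i) (q j) = sqdist (p i) (p j)" if "j \<in> insert i ?N" for j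
  proof (cases "j = i")
    case True
    then show ?thesis using p[OF i] q[OF i] by (simp add: sqdist_def)
  next
    case False
    \<comment> \<open>A bar may carry zero stress, so its length is kept by domination; the other
      edges here have nonzero stress and keep theirs by equality of energies.\<close>
    then have "{i, j} \<in> bars G \<or> ?W i j \<noteq> 0" using that by (auto simp: edge_weight_def edges_def)
    then show ?thesis using dom length_eq[OF i Nn[OF that]] by (auto simp: dominated_by_def)
  qed
  \<comment> \<open>The bound \<open>r + 2 \<le> n\<close> ensures that the natural-number
    subtraction \<open>n - r - 1\<close> is not truncated.\<close>
  have rank: "vec_space.rank ?n (stress_matrix G \<omega>) + (r + 1) = ?n" using assms by simp
  have X: "?X \<subseteq> p ` {..<?n}" using Nn by blast
  \<comment> \<open>Spanning at the one vertex \<open>i\<close> serves twice: to identify the kernel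
    with the affine functions, and to make \<open>g\<close> vanish at the end.\<close>
  have span: "affine_span r ?X = carrier_vec r"
  proof -
    have "?X = {p i} \<union> {p j | j. j \<in> ?N}" by blast
    then show ?thesis using assms(1,9) i by simp
  qed
  define h where "h a b = q a \<bullet> q b - p a \<bullet> p b" for a b
  have h: "h a b = (\<Sum>k<s. q a $ k * q b $ k) - (\<Sum>k<r. p a $ k * p b $ k)" if "a < ?n" "b < ?n" for a b
    using p[OF that(2)] q[OF that(2)] by (simp add: h_def scalar_prod_def lessThan_atLeast0)
  \<comment> \<open>Row \<open>a\<close> of \<open>h\<close> combines the coordinate functions of
    \<open>q\<close> and \<open>p\<close> with fixed coefficients \<open>q a $ k\<close> and
    \<open>- p a $ k\<close>, and each of these functions is in equilibrium.\<close>
  have h_equilibrium: "(\<Sum>j<?n. ?W b j * (h a b - h a j)) = 0" if "a < ?n" "b < ?n" for a b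
  proof -
    have "(\<Sum>j<?n. ?W b j * (h a b - h a j)) =
        (\<Sum>j<?n. (\<Sum>k<s. q a $ k * (?W b j * (q b $ k - q j $ k)))
          - (\<Sum>k<r. p a $ k * (?W b j * (p b $ k - p j $ k))))"
    proof (rule sum.cong[OF refl])
      fix j assume "j \<in> {..<?n}"
      then have j: "j < ?n" by simp
      show "?W b j * (h a b - h a j) = (\<Sum>k<s. q a $ k * (?W b j * (q b $ k - q j $ k)))
          - (\<Sum>k<r. p a $ k * (?W b j * (p b $ k - p j $ k)))"
        unfolding h[OF that] h[OF that(1) j]
        by (simp add: algebra_simps sum_subtractf sum_distrib_left)
    qed
    also have "\<dots> = (\<Sum>k<s. q a $ k * (\<Sum>j<?n. ?W b j * (q b $ k - q j $ k)))
        - (\<Sum>k<r. p a $ k * (\<Sum>j<?n. ?W b j * (p b $ k - p j $ k)))"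
      unfolding sum_subtractf sum_distrib_left by (intro arg_cong2[of _ _ _ _ minus] sum.swap)
    also have "\<dots> = 0" using eq_p eq_q that(2) by simp
    finally show ?thesis .
  qed
  have W_h: "?W b j * (2 * h b j - h b b - h j j) = 0" if "b < ?n" "j < ?n" for b j
    using length_eq[OF that] p[OF that(1)] p[OF that(2)] q[OF that(1)] q[OF that(2)]
    by (auto simp: sqdist_scalar_prod[of _ r] sqdist_scalar_prod[of _ s] h_def)
  \<comment> \<open>Where the weight is nonzero, \<open>h j j = 2 * h b j - h b b\<close>. This
    reduces the claim at \<open>b\<close> to twice the equilibrium of row \<open>b\<close> at
    \<open>b\<close>.\<close>
  have diag_equilibrium: "(\<Sum>j<?n. ?W b j * (h b b - h j j)) = 0" if b: "b < ?n" for b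
  proof -
    have "(\<Sum>j<?n. ?W b j * (h b b - h j j)) = (\<Sum>j<?n. 2 * (?W b j * (h b b - h b j)))"
      using W_h[OF b] by (intro sum.cong) (auto simp: algebra_simps)
    then show ?thesis using h_equilibrium[OF b b] by (simp flip: sum_distrib_left)
  qed
  define g where "g j = 2 * h i j - h i i - h j j" for j
  have g: "g j = sqdist (p i) (p j) - sqdist (q i) (q j)" if "j < ?n" for j
    using p[OF i] p[OF that] q[OF i] q[OF that]
    by (simp add: sqdist_scalar_prod[of _ r] sqdist_scalar_prod[of _ s] h_def g_def)
  \<comment> \<open>The constant \<open>h i i\<close> cancels, leaving twice row \<open>i\<close> of
    \<open>h\<close> minus its diagonal.\<close>
  have "(\<Sum>j<?n. ?W b j * (g b - g j)) = 0" if b: "b < ?n" for b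
  proof -
    have "(\<Sum>j<?n. ?W b j * (g b - g j)) =
        2 * (\<Sum>j<?n. ?W b j * (h i b - h i j)) - (\<Sum>j<?n. ?W b j * (h b b - h j j))"
      unfolding sum_distrib_left sum_subtractf[symmetric]
      by (intro sum.cong) (auto simp: g_def algebra_simps)
    then show ?thesis using h_equilibrium[OF i b] diag_equilibrium[OF b] by simp
  qed
  then obtain u b where u: "u \<in> carrier_vec r" and gu: "\<And>j. j < ?n \<Longrightarrow> g j = u \<bullet> p j + b"
    using equilibrium_affine[OF fp st rank X span] by blast
  have "?X \<subseteq> carrier_vec r" using X p by auto
  moreover have "u \<bullet> x + b = 0" if x: "x \<in> ?X" for x
  proof -
    obtain j where j: "j \<in> insert i ?N" and xj: "x = p j" using x by (rule imageE)
    show ?thesis using gu[OF Nn[OF j]] g[OF Nn[OF j]] N_length[OF j] by (simp add: xj)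
  qed
  ultimately have "u = 0\<^sub>v r" "b = 0"
    using affine_spanning_vanish[OF _ u _ span, of b] by simp_all
  then have "g l = 0" using gu[OF l] p[OF l] by simp
  then show "sqdist (q i) (q l) = sqdist (p i) (p l)" using g[OF l] by simp
qed

end
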